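(* Let $\mathcal A=\{a_1,\dots,a_x\}$ be a multiset of $x$ (not necessarily distinct) integers, and for each $d$ let $\mathcal A_d=\#\{n\le x:\ d\mid a_n\}$. Let $h$ be a real-valued, non-negative multiplicative function with $0\le h(d)\le d$ for all square-free $d$, and for square-free $d$ define $r_d$ by $$\mathcal A_d=\frac{h(d)}{d}\,x+r_d .$$ Let $\mathcal P$ be a finite set of primes, and let $g$ be a real-valued, strongly additive function with $|g(p)|\le M$ for all $p\in\mathcal P$, where $M>0$. Let $$\mu_{\mathcal P}(g)=\sum_{p\in\mathcal P}g(p)\frac{h(p)}{p},\qquad \sigma_{\mathcal P}(g)^2=\sum_{p\in\mathcal P}g(p)^2\,\frac{h(p)}{p}\Big(1-\frac{h(p)}{p}\Big),\qquad \sigma_{\mathcal P}(g)\ge0.$$ Then, uniformly for all even natural numbers $k\le(\sigma_{\mathcal P}(g)/M)^{2/3}$, $$\sum_{a\in\mathcal A}\Big(\sum_{\substack{p\mid a\\ p\in\mathcal P}}g(p)-\mu_{\mathcal P}(g)\Big)^k = C_k\,x\,\sigma_{\mathcal P}(g)^k\Big(1+O\Big(\frac{k^3M^2}{\sigma_{\mathcal P}(g)^2}\Big)\Big)+O\Big(M^k\Big(\sum_{p\in\mathcal P}\frac{h(p)}{p}\Big)^k\sum_{d\in D_k(\mathcal P)}|r_d|\Big),$$ while for all odd natural numbers $k\le(\sigma_{\mathcal P}(g)/M)^{2/3}$, uniformly, $$\sum_{a\in\mathcal A}\Big(\sum_{\substack{p\mid a\\ p\in\mathcal P}}g(p)-\mu_{\mathcal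 P}(g)\Big)^k \ll C_k\,x\,\sigma_{\mathcal P}(g)^k\,\frac{k^{3/2}M}{\sigma_{\mathcal P}(g)}+M^k\Big(\sum_{p\in\mathcal P}\frac{h(p)}{p}\Big)^k\sum_{d\in D_k(\mathcal P)}|r_d|.$$
   Context: For a natural number $k\ge1$, $C_k=\Gamma(k+1)/(2^{k/2}\,\Gamma(k/2+1))$. A function $g$ on the natural numbers is additive if $g(1)=0$ and $g(mn)=g(m)+g(n)$ whenever $m$ and $n$ are coprime; it is strongly additive if in addition $g(p^j)=g(p)$ for all primes $p$ and all $j\ge1$. $D_k(\mathcal P)$ denotes the set of square-free integers which are the product of at most $k$ primes all from the set $\mathcal P$. Sums over $a\in\mathcal A$ are taken with multiplicity. The implied constants in $O(\cdot)$ and $\ll$ are absolute (independent of $\mathcal A$, $x$, $h$, $\mathcal P$, $g$, $M$ and $k$); $A\ll B$ means $|A|\le cB$ for an absolute constant $c$. *)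

theory Defs
  imports "HOL-Analysis.Gamma_Function" "HOL-Computational_Algebra.Squarefree"
begin

(* Arithmetic functions have type nat => real; their value at 0 is irrelevant. *)

definition multiplicative_fun :: "(nat \<Rightarrow> real) \<Rightarrow> bool" where
  "multiplicative_fun h \<longleftrightarrow>
     h 1 = 1 \<and> (\<forall>m>0. \<forall>n>0. coprime m n \<longrightarrow> h (m * n) = h m * h n)"

definition additive_fun :: "(nat \<Rightarrow> real) \<Rightarrow> bool" where
  "additive_fun g \<longleftrightarrow>
     g 1 = 0 \<and> (\<forall>m>0. \<forall>n>0. coprime m n \<longrightarrow> g (m * n) = g m + g n)"

definition strongly_additive_fun :: "(nat \<Rightarrow> real) \<Rightarrow> bool" where
  "strongly_additive_fun g \<longleftrightarrow>
     additive_fun g \<and> (\<forall>p j. prime p \<longrightarrow> j \<ge> 1 \<longrightarrow> g (p ^ j) = g p)"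

definition C :: "nat \<Rightarrow> real" where
  "C k = Gamma (real k + 1) / (2 powr (real k / 2) * Gamma (real k / 2 + 1))"

definition count_multiples :: "int multiset \<Rightarrow> nat \<Rightarrow> nat" where
  "count_multiples A d = size {#a \<in># A. int d dvd a#}"

definition remainder :: "int multiset \<Rightarrow> (nat \<Rightarrow> real) \<Rightarrow> nat \<Rightarrow> real" where
  "remainder A h d = real (count_multiples A d) - h d / real d * real (size A)"

definition mean :: "(nat \<Rightarrow> real) \<Rightarrow> nat set \<Rightarrow> (nat \<Rightarrow> real) \<Rightarrow> real" where
  "mean h P g = (\<Sum>p\<in>P. g p * (h p / real p))"

(* The sum is non-negative whenever 0 <= h p <= p for all p in P, so that sqrt then is
   the genuine non-negative square root. *)
definition std_dev :: "(nat \<Rightarrow> real) \<Rightarrow> nat set \<Rightarrow> (nat \<Rightarrow> real) \<Rightarrow> real" where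
  "std_dev h P g = sqrt (\<Sum>p\<in>P. (g p)\<^sup>2 * (h p / real p) * (1 - h p / real p))"

(* The empty product is allowed: 1 is always an element. *)
definition D :: "nat \<Rightarrow> nat set \<Rightarrow> nat set" where
  "D k P = {d. squarefree d \<and>
     (\<exists>Q. (\<forall>p\<in>#Q. prime p \<and> p \<in> P) \<and> size Q \<le> k \<and> d = prod_mset Q)}"

lemma finite_D:
  assumes "finite P"
  shows "finite (D k P)"
proof -
  have "D k P \<subseteq> prod_mset ` (mset ` {xs. set xs \<subseteq> P \<and> length xs \<le> k})"
  proof
    fix d assume "d \<in> D k P"
    then obtain Q where Q: "\<forall>p\<in>#Q. p \<in> P" "size Q \<le> k" "d = prod_mset Q"
      by (auto simp: D_def)
    obtain xs where "mset xs = Q" using ex_mset by blast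
    with Q show "d \<in> prod_mset ` (mset ` {xs. set xs \<subseteq> P \<and> length xs \<le> k})"
      by (intro image_eqI[of _ _ Q] image_eqI[of _ _ xs]) auto
  qed
  then show ?thesis
    using finite_lists_length_le[OF assms] finite_subset by blast
qed

end

theory Submission
  imports Defs "HOL-Computational_Algebra.Formal_Power_Series"
begin

text \<open>Write \<open>l p = h p / p\<close>, and regard the divisibility of \<open>a\<close> by the primes \<open>p\<close> of \<open>P\<close> as
independent events of probability \<open>l p\<close>, up to the errors \<open>r\<^sub>d\<close>. Both the independent model and
the errors are read off from exponential generating functions. For a single \<open>a\<close> the \<open>k\<close>-th power
is \<open>k!\<close> times the coefficient of \<open>t\<^sup>k\<close> in the product over \<open>p\<close> of
\<open>exp (t g(p) (1\<^sub>p\<^sub>|\<^sub>a - l p))\<close>, and each factor is affine in the indicator of \<open>p | a\<close>.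
Multiplying out gives a sum over subsets \<open>Q\<close> of \<open>P\<close>, in which \<open>a\<close> enters only through the
indicator that \<open>\<Prod>Q\<close> divides \<open>a\<close>. Summing over \<open>a\<close> replaces this indicator by
\<open>x \<Prod>\<^sub>Q l p + r\<^sub>\<Prod>\<^sub>Q\<close> (\<open>power_sum_remainder_split\<close>).

The errors. The factor belonging to a prime of \<open>Q\<close> has no constant term, so only sets \<open>Q\<close> with at
most \<open>k\<close> elements contribute. Coefficientwise this factor is dominated by \<open>exp (M t)\<close>, and the
factor belonging to a prime outside \<open>Q\<close> by \<open>exp (M l(p) t)\<close>. Hence the weight of \<open>r\<^sub>\<Prod>\<^sub>Q\<close> is at
most \<open>M\<^sup>k (k + \<Sum> l(p))\<^sup>k\<close>. The hypothesis on \<open>k\<close> forces \<open>\<Sum> l(p) \<ge> \<sigma>\<^sup>2 / M\<^sup>2 \<ge> k\<^sup>3\<close>, and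
therefore the summand \<open>k\<close> costs only a bounded factor (\<open>abs_sum_remainder_le\<close>).

The main term. What remains is the \<open>k\<close>-th moment of a sum of independent centred Bernoulli
variables, scaled by \<open>g(p)\<close>. Dividing the generating function of each of them by the generating
function \<open>exp (v t\<^sup>2 / 2)\<close> of the Gaussian with the same variance \<open>v\<close> leaves a series
\<open>1 + O(v M t\<^sup>3)\<close>. Let \<open>R\<close> be the product of these quotients, so that the moment is \<open>k!\<close> times the
coefficient of \<open>t\<^sup>k\<close> in \<open>R exp (\<sigma>\<^sup>2 t\<^sup>2 / 2)\<close>. The constant term of \<open>R\<close> produces the Gaussian moment
\<open>C\<^sub>k \<sigma>\<^sup>k\<close>. Relative to it, the coefficient of \<open>t\<^sup>j\<close> in \<open>R\<close> matters by at most that coefficient times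
\<open>2 (\<surd>k / \<sigma>)\<^sup>j\<close>. With \<open>\<epsilon> = k\<^sup>3\<^sup>/\<^sup>2 M / \<sigma> \<le> 1\<close> it has to be shown that at \<open>t = \<surd>k / \<sigma>\<close> the odd part of \<open>R\<close>
is \<open>O(\<epsilon>)\<close> and that its even part is \<open>1 + O(\<epsilon>\<^sup>2)\<close>. Both bounds come from one submultiplicative norm,
in which odd coefficients are divided by \<open>\<epsilon>\<close> and even ones, except the constant term, by \<open>\<epsilon>\<^sup>2\<close>: the norm of
\<open>R\<close> is at most the product of the norms of its factors, hence bounded
(\<open>weighted_norm_ratio_egf_le\<close>, \<open>centred_moment_bounds\<close>).\<close>

section \<open>Products of distinct primes\<close>

lemma prod_primes_dvd_iff:
  fixes a :: int
  assumes "finite Q" "\<And>p. p \<in> Q \<Longrightarrow> prime (p :: nat)"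
  shows "int (\<Prod>Q) dvd a \<longleftrightarrow> (\<forall>p\<in>Q. int p dvd a)"
  using assms
proof (induction rule: finite_induct)
  case (insert p Q)
  have "coprime p (\<Prod>Q)"
    using insert by (intro prod_coprime_right) (auto intro!: primes_coprime)
  hence "coprime (int p) (int (\<Prod>Q))" by (simp only: coprime_int_iff)
  hence "int p * int (\<Prod>Q) dvd a \<longleftrightarrow> int p dvd a \<and> int (\<Prod>Q) dvd a"
    by (auto intro: divides_mult dest: dvd_mult_left dvd_mult_right)
  with insert show ?case by simp
qed simp

lemma multiplicative_fun_prod_primes:
  assumes h: "multiplicative_fun h"
    and "finite Q" "\<And>p. p \<in> Q \<Longrightarrow> prime p"
  shows "h (\<Prod>Q) = (\<Prod>p\<in>Q. h p)"
  using assms(2,3)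
proof (induction rule: finite_induct)
  case empty
  show ?case using h by (simp add: multiplicative_fun_def)
next
  case (insert p Q)
  have "coprime p (\<Prod>Q)"
    using insert by (intro prod_coprime_right) (auto intro!: primes_coprime)
  moreover have "\<Prod>Q > 0" "p > 0" using insert by (auto intro!: prod_pos prime_gt_0_nat)
  ultimately have "h (p * \<Prod>Q) = h p * h (\<Prod>Q)" using h by (simp add: multiplicative_fun_def)
  with insert show ?case by simp
qed

lemma inj_on_prod_primes:
  assumes "finite P" "\<And>p. p \<in> P \<Longrightarrow> prime (p :: nat)"
  shows "inj_on \<Prod> (Pow P)"
proof (rule inj_onI)
  fix Q R assume QR: "Q \<in> Pow P" "R \<in> Pow P" and eq: "\<Prod>Q = \<Prod>R"
  have "prime_factors (\<Prod>S) = S" if "S \<in> Pow P" for S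
  proof -
    have "finite S" using that assms(1) finite_subset by blast
    moreover have "0 \<notin> S" using that assms(2)[of 0] by auto
    ultimately
    have "prime_factors (\<Prod>S) = (\<Union>p\<in>S. prime_factors p)"
      by (subst prime_factors_prod) auto
    also have "\<dots> = (\<Union>p\<in>S. {p})"
      using that assms by (intro SUP_cong) (auto simp: prime_factorization_prime)
    finally show ?thesis by simp
  qed
  thus "Q = R" using QR eq by metis
qed

lemma prod_primes_in_D:
  assumes "finite P" "\<And>p. p \<in> P \<Longrightarrow> prime p" "Q \<subseteq> P" "card Q \<le> k"
  shows "\<Prod>Q \<in> D k P"
proof -
  have fin: "finite Q" using assms finite_subset by blast
  have "squarefree (\<Prod>Q)"
  proof (rule squarefree_prod_coprime)
    fix p q assume "p \<in> Q" "q \<in> Q" "p \<noteq> q"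
    thus "coprime p q" using assms(2,3) by (intro primes_coprime) auto
  next
    fix p assume "p \<in> Q"
    thus "squarefree p" using assms(2,3) by (intro squarefree_prime) auto
  qed
  moreover have "\<Prod>Q = prod_mset (mset_set Q)" by (simp add: prod_unfold_prod_mset)
  moreover have "\<forall>p\<in>#mset_set Q. prime p \<and> p \<in> P" using assms(2,3) fin by auto
  ultimately show ?thesis using assms(4) by (auto simp: D_def intro!: exI[of _ "mset_set Q"])
qed

lemma sum_small_subsets_le_sum_D:
  fixes f :: "nat \<Rightarrow> real"
  assumes "finite P" "\<And>p. p \<in> P \<Longrightarrow> prime p" "\<And>d. f d \<ge> 0"
  shows "(\<Sum>Q\<in>{Q\<in>Pow P. card Q \<le> k}. f (\<Prod>Q)) \<le> (\<Sum>d\<in>D k P. f d)"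
proof -
  have inj: "inj_on \<Prod> {Q\<in>Pow P. card Q \<le> k}"
    using inj_on_prod_primes[OF assms(1,2)] by (rule inj_on_subset) auto
  have "(\<Sum>Q\<in>{Q\<in>Pow P. card Q \<le> k}. f (\<Prod>Q)) = (\<Sum>d\<in>\<Prod> ` {Q\<in>Pow P. card Q \<le> k}. f d)"
    using inj by (simp add: sum.reindex)
  also have "\<dots> \<le> (\<Sum>d\<in>D k P. f d)"
    using assms prod_primes_in_D[OF assms(1,2)] finite_D[OF assms(1)]
    by (intro sum_mono2) auto
  finally show ?thesis .
qed

section \<open>Expansion of the power over subsets of primes\<close>

lemma prod_fps_exp:
  fixes f :: "'a \<Rightarrow> 'b::field_char_0"
  shows "(\<Prod>x\<in>A. fps_exp (f x)) = fps_exp (\<Sum>x\<in>A. f x)"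
  by (induction A rule: infinite_finite_induct) (simp_all add: fps_exp_add_mult)

definition majorized :: "real fps \<Rightarrow> real fps \<Rightarrow> bool" where
  "majorized f F \<longleftrightarrow> (\<forall>n. \<bar>fps_nth f n\<bar> \<le> fps_nth F n)"

lemma majorized_mult:
  assumes "majorized f F" "majorized g G"
  shows "majorized (f * g) (F * G)"
  unfolding majorized_def
proof
  fix n
  have "\<bar>fps_nth (f * g) n\<bar> \<le> (\<Sum>i=0..n. \<bar>fps_nth f i * fps_nth g (n - i)\<bar>)"
    unfolding fps_mult_nth by (rule sum_abs)
  also have "\<dots> \<le> (\<Sum>i=0..n. fps_nth F i * fps_nth G (n - i))"
    using assms by (intro sum_mono) (auto simp: majorized_def abs_mult intro!: mult_mono order_trans[OF abs_ge_zero])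
  finally show "\<bar>fps_nth (f * g) n\<bar> \<le> fps_nth (F * G) n" by (simp add: fps_mult_nth)
qed

lemma majorized_prod:
  assumes "\<And>x. x \<in> A \<Longrightarrow> majorized (f x) (F x)"
  shows "majorized (\<Prod>x\<in>A. f x) (\<Prod>x\<in>A. F x)"
  using assms
proof (induction A rule: infinite_finite_induct)
  case (insert x A)
  thus ?case by (auto intro: majorized_mult)
qed (auto simp: majorized_def)

lemma majorized_fps_exp: "\<bar>c\<bar> \<le> M \<Longrightarrow> majorized (fps_exp c) (fps_exp M)"
  by (auto simp: majorized_def power_abs intro!: divide_right_mono power_mono)

text \<open>For \<open>n = 0\<close> the two powers cancel, and for \<open>n > 0\<close> the bound is \<open>(1 - l) + l\<close>. The same
quantity governs both the error weights and the moments of a centred Bernoulli variable.\<close>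

lemma abs_diff_power_le_1:
  fixes l :: real
  assumes "0 \<le> l" "l \<le> 1" 
  shows "\<bar>(1 - l) ^ n - (- l) ^ n\<bar> \<le> 1"
proof (cases n)
  case (Suc m)
  have "\<bar>(1 - l) ^ n - (- l) ^ n\<bar> \<le> (1 - l) ^ n + l ^ n"
    using abs_triangle_ineq4[of "(1 - l) ^ n" "(- l) ^ n"] assms by (simp add: power_abs)
  also have "\<dots> \<le> (1 - l) + l"
    using assms Suc by (intro add_mono) (auto intro!: mult_left_le power_le_one)
  finally show ?thesis by simp
qed simp

text \<open>The factor \<open>exp (t g (1\<^sub>p\<^sub>|\<^sub>a - l))\<close> takes two values: this one when \<open>p\<close> does not divide \<open>a\<close>, and this
one plus the jump below when it does.\<close>
definition off_egf :: "real \<Rightarrow> real \<Rightarrow> real fps" where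
  "off_egf l g = fps_exp (- (g * l))"

definition jump_egf :: "real \<Rightarrow> real \<Rightarrow> real fps" where
  "jump_egf l g = fps_exp (g * (1 - l)) - off_egf l g"

text \<open>The coefficient with which the event that all primes of \<open>Q\<close> divide \<open>a\<close> enters the \<open>k\<close>-th power.\<close>
definition subset_weight :: 
  "('a \<Rightarrow> real) \<Rightarrow> ('a \<Rightarrow> real) \<Rightarrow> 'a set \<Rightarrow> nat \<Rightarrow> 'a set \<Rightarrow> real" where
  "subset_weight l g P k Q =
     fact k * fps_nth ((\<Prod>p\<in>Q. jump_egf (l p) (g p)) * (\<Prod>p\<in>P - Q. off_egf (l p) (g p))) k"

text \<open>The exponential turns the sum over \<open>P\<close> into a product of terms affine in the indicators of \<open>B p\<close>, and
a product of indicators over \<open>Q\<close> is the indicator of the conjunction. A prime that would occur several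
times in a term of the \<open>k\<close>-th power occurs once in \<open>Q\<close>; its multiplicity is hidden in the series.\<close>

lemma power_centred_sum_expand:
  fixes l g :: "'a \<Rightarrow> real"
  assumes P: "finite P"
  shows "((\<Sum>p\<in>{p\<in>P. B p}. g p) - (\<Sum>p\<in>P. g p * l p)) ^ k =
           (\<Sum>Q\<in>Pow P. of_bool (\<forall>p\<in>Q. B p) * subset_weight l g P k Q)" (is "?s ^ k = _")
proof -
  let ?b = "\<lambda>p. of_bool (B p) :: real fps"
  have "?s = (\<Sum>p\<in>P. g p * (of_bool (B p) - l p))"
  proof -
    have "(\<Sum>p\<in>{p\<in>P. B p}. g p) = (\<Sum>p\<in>P. g p * of_bool (B p))"
      unfolding sum.inter_filter[OF P] by (intro sum.cong) auto
    thus ?thesis by (simp add: right_diff_distrib sum_subtractf)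
  qed
  hence "fps_exp ?s = (\<Prod>p\<in>P. fps_exp (g p * (of_bool (B p) - l p)))"
    by (simp add: prod_fps_exp)
  also have "\<dots> = (\<Prod>p\<in>P. ?b p * jump_egf (l p) (g p) + off_egf (l p) (g p))"
    by (intro prod.cong) (auto simp: jump_egf_def off_egf_def)
  also have "\<dots> = (\<Sum>Q\<in>Pow P. (\<Prod>p\<in>Q. ?b p * jump_egf (l p) (g p)) *
                               (\<Prod>p\<in>P - Q. off_egf (l p) (g p)))"
    by (rule prod_add[OF P])
  also have "\<dots> = (\<Sum>Q\<in>Pow P. fps_const (of_bool (\<forall>p\<in>Q. B p)) * ((\<Prod>p\<in>Q. jump_egf (l p) (g p)) *
                               (\<Prod>p\<in>P - Q. off_egf (l p) (g p))))"
  proof (intro sum.cong refl)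
    fix Q assume "Q \<in> Pow P"
    hence "finite Q" using P finite_subset by blast
    hence "(\<Prod>p\<in>Q. ?b p) = fps_const (of_bool (\<forall>p\<in>Q. B p))"
      by (induction rule: finite_induct) auto
    thus "(\<Prod>p\<in>Q. ?b p * jump_egf (l p) (g p)) * (\<Prod>p\<in>P - Q. off_egf (l p) (g p)) =
        fps_const (of_bool (\<forall>p\<in>Q. B p)) * ((\<Prod>p\<in>Q. jump_egf (l p) (g p)) *
                               (\<Prod>p\<in>P - Q. off_egf (l p) (g p)))"
      by (simp add: prod.distrib mult.assoc)
  qed
  finally have eq: "fps_exp ?s = \<dots>" .
  have "?s ^ k = fact k * fps_nth (fps_exp ?s) k" by simp
  also have "\<dots> = (\<Sum>Q\<in>Pow P. of_bool (\<forall>p\<in>Q. B p) * subset_weight l g P k Q)"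
    unfolding eq fps_sum_nth sum_distrib_left fps_mult_left_const_nth subset_weight_def
    by (simp add: mult_ac)
  finally show ?thesis .
qed

text \<open>Every jump is divisible by \<open>t\<close>, so the product over \<open>Q\<close> starts in degree \<open>card Q\<close>.\<close>

lemma subset_weight_eq_0:
  assumes "k < card Q"
  shows "subset_weight l g P k Q = 0"
proof -
  have "jump_egf x y = fps_X * fps_shift 1 (jump_egf x y)" for x y
    by (rule fps_ext) (auto simp: jump_egf_def off_egf_def)
  hence "(\<Prod>p\<in>Q. jump_egf (l p) (g p)) = (\<Prod>p\<in>Q. fps_X * fps_shift 1 (jump_egf (l p) (g p)))"
    by (intro prod.cong) auto
  also have "\<dots> = fps_X ^ card Q * (\<Prod>p\<in>Q. fps_shift 1 (jump_egf (l p) (g p)))"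
    by (simp add: prod.distrib)
  finally show ?thesis
    using assms by (simp add: subset_weight_def mult.assoc fps_X_power_mult_nth)
qed

text \<open>Since \<open>\<bar>(1 - l)\<^sup>n - (- l)\<^sup>n\<bar> \<le> 1\<close>, a jump is dominated by \<open>exp (M t)\<close>; the remaining factors are
dominated by \<open>exp (M l t)\<close>. Exponentials multiply to one exponential, whose coefficients are known exactly.\<close>

lemma abs_subset_weight_le:
  assumes P: "finite P" and Q: "Q \<subseteq> P"
    and l: "\<And>p. p \<in> P \<Longrightarrow> 0 \<le> l p \<and> l p \<le> 1" and g: "\<And>p. p \<in> P \<Longrightarrow> \<bar>g p\<bar> \<le> M" 
    and M: "M \<ge> 0"
  shows "\<bar>subset_weight l g P k Q\<bar> \<le> M ^ k * (real (card Q) + (\<Sum>p\<in>P. l p)) ^ k"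
proof -
  let ?s = "\<Sum>p\<in>P - Q. l p"
  have off: "majorized (off_egf (l p) (g p)) (fps_exp (M * l p))" if "p \<in> P" for p
    unfolding off_egf_def using l[OF that] g[OF that]
    by (intro majorized_fps_exp) (auto simp: abs_mult intro!: mult_right_mono)
  have jump: "majorized (jump_egf (l p) (g p)) (fps_exp M)" if "p \<in> P" for p
    unfolding majorized_def
  proof
    fix n
    have "fps_nth (jump_egf (l p) (g p)) n = g p ^ n / fact n * ((1 - l p) ^ n - (- l p) ^ n)"
    proof -
      have "(g p * (1 - l p)) ^ n = g p ^ n * (1 - l p) ^ n" "(- (g p * l p)) ^ n = g p ^ n * (- l p) ^ n"
        by (simp_all flip: power_mult_distrib)
      thus ?thesis
        by (simp only: jump_egf_def off_egf_def fps_sub_nth fps_exp_nth of_nat_fact)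
           (simp add: right_diff_distrib diff_divide_distrib)
    qed
    hence "\<bar>fps_nth (jump_egf (l p) (g p)) n\<bar> = \<bar>g p\<bar> ^ n / fact n * \<bar>(1 - l p) ^ n - (- l p) ^ n\<bar>"
      by (simp add: abs_mult power_abs)
    also have "\<dots> \<le> M ^ n / fact n * 1"
      using abs_diff_power_le_1[of "l p" n] l[OF that] g[OF that] M
      by (intro mult_mono divide_right_mono power_mono) auto
    finally show "\<bar>fps_nth (jump_egf (l p) (g p)) n\<bar> \<le> fps_nth (fps_exp M) n" by simp
  qed
  have "majorized ((\<Prod>p\<in>Q. jump_egf (l p) (g p)) * (\<Prod>p\<in>P - Q. off_egf (l p) (g p)))
          ((\<Prod>p\<in>Q. fps_exp M) * (\<Prod>p\<in>P - Q. fps_exp (M * l p)))"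
    using Q by (intro majorized_mult majorized_prod off jump) auto
  also have "(\<Prod>p\<in>Q. fps_exp M) * (\<Prod>p\<in>P - Q. fps_exp (M * l p)) = fps_exp (M * (real (card Q) + ?s))"
    unfolding prod_fps_exp fps_exp_add_mult[symmetric] 
    by (simp add: sum_distrib_left algebra_simps)
  finally have maj: "majorized ((\<Prod>p\<in>Q. jump_egf (l p) (g p)) * (\<Prod>p\<in>P - Q. off_egf (l p) (g p)))
     (fps_exp (M * (real (card Q) + ?s)))" .
  have s: "0 \<le> ?s" "?s \<le> (\<Sum>p\<in>P. l p)"
    using P l by (auto intro!: sum_nonneg sum_mono2)
  have "\<bar>subset_weight l g P k Q\<bar> \<le> fact k * fps_nth (fps_exp (M * (real (card Q) + ?s))) k"
    using maj unfolding subset_weight_def majorized_def abs_mult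
    by (simp only: abs_of_nonneg[OF fact_ge_zero]) (intro mult_left_mono, blast, rule fact_ge_zero)
  also have "\<dots> = M ^ k * (real (card Q) + ?s) ^ k" by (simp add: power_mult_distrib)
  also have "\<dots> \<le> M ^ k * (real (card Q) + (\<Sum>p\<in>P. l p)) ^ k"
    using M s by (intro mult_left_mono power_mono add_left_mono) auto
  finally show ?thesis .
qed

text \<open>The moment generating function of \<open>g (X - l)\<close>, where \<open>X\<close> is Bernoulli with mean \<open>l\<close>.\<close>
definition centred_egf :: "real \<Rightarrow> real \<Rightarrow> real fps" where
  "centred_egf l g = fps_const l * fps_exp (g * (1 - l)) + fps_const (1 - l) * fps_exp (- (g * l))"

text \<open>Replacing the indicator of each prime by its probability folds the expansion back into a product: this
is the moment of the independent model.\<close>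

lemma sum_prod_subset_weight:
  fixes l g :: "'a \<Rightarrow> real"
  assumes P: "finite P"
  shows "(\<Sum>Q\<in>Pow P. (\<Prod>p\<in>Q. l p) * subset_weight l g P k Q) =
           fact k * fps_nth (\<Prod>p\<in>P. centred_egf (l p) (g p)) k"
proof -
  have const: "(\<Prod>p\<in>Q. fps_const (l p)) = fps_const (\<Prod>p\<in>Q. l p)" for Q
    by (induction Q rule: infinite_finite_induct) simp_all
  have "(\<Prod>p\<in>P. centred_egf (l p) (g p)) =
          (\<Prod>p\<in>P. fps_const (l p) * jump_egf (l p) (g p) + off_egf (l p) (g p))"
  proof (intro prod.cong refl)
    fix p
    have "fps_const (1 - l p) = 1 - fps_const (l p)" by (simp flip: fps_const_sub)
    thus "centred_egf (l p) (g p) = fps_const (l p) * jump_egf (l p) (g p) + off_egf (l p) (g p)"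
      by (simp only: centred_egf_def jump_egf_def off_egf_def) (simp add: algebra_simps)
  qed
  also have "\<dots> = (\<Sum>Q\<in>Pow P. (\<Prod>p\<in>Q. fps_const (l p) * jump_egf (l p) (g p)) *
                               (\<Prod>p\<in>P - Q. off_egf (l p) (g p)))"
    by (rule prod_add[OF P])
  also have "\<dots> = (\<Sum>Q\<in>Pow P. fps_const (\<Prod>p\<in>Q. l p) * ((\<Prod>p\<in>Q. jump_egf (l p) (g p)) *
                               (\<Prod>p\<in>P - Q. off_egf (l p) (g p))))"
    by (simp add: prod.distrib const mult.assoc)
  finally show ?thesis
    by (simp add: fps_sum_nth subset_weight_def sum_distrib_left mult_ac)
qed

section \<open>Gaussian and centred Bernoulli generating functions\<close>

text \<open>The series \<open>exp (v t\<^sup>2 / 2)\<close>. For \<open>v \<ge> 0\<close> it is the moment generating function of a centred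
Gaussian of variance \<open>v\<close>; for \<open>v < 0\<close> it serves as the inverse of one.\<close>
definition gauss_egf :: "real \<Rightarrow> real fps" where
  "gauss_egf v = fps_compose (fps_exp (v / 2)) (fps_X ^ 2)"

lemma fps_nth_gauss_egf:
  "fps_nth (gauss_egf v) n = (if even n then (v / 2) ^ (n div 2) / fact (n div 2) else 0)"
proof -
  have "fps_nth (gauss_egf v) n = (\<Sum>i=0..n. if n = 2 * i then (v / 2) ^ i / fact i else 0)"
    unfolding gauss_egf_def fps_compose_nth
    by (intro sum.cong) (auto simp flip: power_mult)
  also have "\<dots> = (\<Sum>i\<in>(if even n then {n div 2} else {}). (v / 2) ^ i / fact i)"
    by (intro sum.mono_neutral_cong_right) (auto split: if_splits)
  finally show ?thesis by simp
qed

lemma gauss_egf_0: "gauss_egf 0 = 1"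
  by (rule fps_ext) (auto simp: fps_nth_gauss_egf elim!: evenE)

lemma gauss_egf_add: "gauss_egf (v + w) = gauss_egf v * gauss_egf w"
  by (simp add: gauss_egf_def add_divide_distrib fps_exp_add_mult fps_compose_mult_distrib)

lemma prod_gauss_egf: "(\<Prod>x\<in>A. gauss_egf (v x)) = gauss_egf (\<Sum>x\<in>A. v x)"
  by (induction A rule: infinite_finite_induct) (simp_all add: gauss_egf_0 gauss_egf_add)

lemma fps_nth_centred_egf:
  "fps_nth (centred_egf l g) n = g ^ n / fact n * (l * (1 - l) ^ n + (1 - l) * (- l) ^ n)"
proof -
  have "(- (g * l)) ^ n = g ^ n * (- l) ^ n"
    by (simp flip: power_mult_distrib)
  moreover have "(g * (1 - l)) ^ n = g ^ n * (1 - l) ^ n" by (rule power_mult_distrib)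
  ultimately show ?thesis
    by (simp only: centred_egf_def fps_add_nth fps_mult_left_const_nth fps_exp_nth of_nat_fact)
       (simp add: distrib_left add_divide_distrib mult_ac)
qed

text \<open>Beyond the first moment, a factor \<open>l (1 - l)\<close> splits off from \<open>l (1 - l)\<^sup>n + (1 - l) (- l)\<^sup>n\<close>. This keeps the
variance visible in the bound, so that the bounds can later be summed over \<open>p\<close> to give \<open>\<sigma>\<^sup>2\<close>.\<close>

lemma abs_fps_nth_centred_egf_le:
  assumes "0 \<le> l" "l \<le> 1" "\<bar>g\<bar> \<le> M" "n \<ge> 2"
  shows "\<bar>fps_nth (centred_egf l g) n\<bar> \<le> g\<^sup>2 * l * (1 - l) * M ^ (n - 2)"
proof -
  obtain m where n: "n = Suc (Suc m)" using assms(4) by (auto simp: numeral_2_eq_2 dest: Suc_le_D)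
  have "l * (1 - l) ^ n + (1 - l) * (- l) ^ n = l * (1 - l) * ((1 - l) ^ Suc m - (- l) ^ Suc m)"
    by (simp add: n algebra_simps)
  hence "\<bar>fps_nth (centred_egf l g) n\<bar> =
      g\<^sup>2 * \<bar>g\<bar> ^ m * (l * (1 - l) * \<bar>(1 - l) ^ Suc m - (- l) ^ Suc m\<bar>) / fact n"
    using assms by (simp add: fps_nth_centred_egf abs_mult power_abs n power2_eq_square mult_ac)
  also have "\<dots> \<le> g\<^sup>2 * \<bar>g\<bar> ^ m * (l * (1 - l) * \<bar>(1 - l) ^ Suc m - (- l) ^ Suc m\<bar>) / 1"
    using assms fact_ge_1 by (intro divide_left_mono mult_nonneg_nonneg) auto
  also have "\<dots> \<le> g\<^sup>2 * M ^ m * (l * (1 - l) * 1) / 1"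
  proof (rule divide_right_mono[OF mult_mono])
    show "g\<^sup>2 * \<bar>g\<bar> ^ m \<le> g\<^sup>2 * M ^ m"
      using assms(3) by (intro mult_left_mono power_mono) auto
    show "l * (1 - l) * \<bar>(1 - l) ^ Suc m - (- l) ^ Suc m\<bar> \<le> l * (1 - l) * 1"
      using assms(1,2) abs_diff_power_le_1[of l "Suc m"] by (intro mult_left_mono) auto
  qed (use assms in auto)
  finally show ?thesis by (simp add: n mult_ac)
qed

text \<open>The quotient of the Bernoulli generating function by the Gaussian one of equal mean and variance. It
measures the deviation from the normal law, which starts in degree three.\<close>
definition ratio_egf :: "real \<Rightarrow> real \<Rightarrow> real fps" where
  "ratio_egf l g = centred_egf l g * gauss_egf (- (g\<^sup>2 * l * (1 - l)))"

text \<open>Two bounds on the same coefficients: the first decays geometrically relative to \<open>M\<^sup>n\<close> and makes a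
convolution summable, the second retains one factor \<open>v\<close> for the term of the convolution in which the other
series contributes only its constant term.\<close>

lemma abs_fps_nth_gauss_egf_le:
  assumes v: "0 \<le> v" "v \<le> M\<^sup>2 / 4" and M: "M > 0"
  shows "\<bar>fps_nth (gauss_egf (- v)) n\<bar> \<le> (M / 2) ^ n"
    and "n > 0 \<Longrightarrow> \<bar>fps_nth (gauss_egf (- v)) n\<bar> \<le> v * M ^ (n - 2)"
proof -
  have main: "\<bar>fps_nth (gauss_egf (- v)) (2 * i)\<bar> \<le> (v / 2) ^ i" for i
  proof -
    have "\<bar>fps_nth (gauss_egf (- v)) (2 * i)\<bar> = (v / 2) ^ i / fact i"
      using v by (simp add: fps_nth_gauss_egf power_abs)
    also have "\<dots> \<le> (v / 2) ^ i / 1"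
      using v fact_ge_1[of i] by (intro divide_left_mono) auto
    finally show ?thesis by simp
  qed
  have le: "v / 2 \<le> (M / 2)\<^sup>2" "v / 2 \<le> M\<^sup>2" using v by (auto simp: power_divide)
  {
    fix i
    have "(v / 2) ^ i \<le> ((M / 2)\<^sup>2) ^ i" using le v by (intro power_mono) auto
    with main[of i] have "\<bar>fps_nth (gauss_egf (- v)) (2 * i)\<bar> \<le> (M / 2) ^ (2 * i)"
      by (simp add: power_mult)
  }
  thus "\<bar>fps_nth (gauss_egf (- v)) n\<bar> \<le> (M / 2) ^ n"
    using M by (cases "even n") (auto simp: fps_nth_gauss_egf elim!: evenE)
  {
    fix i
    have "(v / 2) ^ Suc i = v / 2 * (v / 2) ^ i" by simp
    also have "\<dots> \<le> v * (M\<^sup>2) ^ i" using le v by (intro mult_mono power_mono) auto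
    finally have "\<bar>fps_nth (gauss_egf (- v)) (2 * Suc i)\<bar> \<le> v * M ^ (2 * Suc i - 2)"
      using main[of "Suc i"] by (simp add: power_mult)
  } note * = this
  show "\<bar>fps_nth (gauss_egf (- v)) n\<bar> \<le> v * M ^ (n - 2)" if "n > 0"
  proof (cases "even n")
    case True
    then obtain j where "n = 2 * j" by (elim evenE)
    moreover from this that obtain i where "j = Suc i" by (cases j) auto
    ultimately show ?thesis using *[of i] by simp
  qed (use v M in \<open>auto simp: fps_nth_gauss_egf\<close>)
qed

lemma mult_one_minus_le_quarter: "l * (1 - l) \<le> 1 / (4::real)"
proof -
  have "0 \<le> (l - 1 / 2)\<^sup>2" by simp
  thus ?thesis by (simp add: power2_eq_square algebra_simps)
qed

lemma ratio_egf_low_coeffs: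
  "fps_nth (ratio_egf l g) 0 = 1" "fps_nth (ratio_egf l g) 1 = 0" "fps_nth (ratio_egf l g) 2 = 0"
proof -
  let ?c = "fps_nth (centred_egf l g)" and ?e = "fps_nth (gauss_egf (- (g\<^sup>2 * l * (1 - l))))"
  have c: "?c 0 = 1" "?c 1 = 0" "?c 2 = g\<^sup>2 * l * (1 - l) / 2"
    by (simp_all add: fps_nth_centred_egf) (simp add: power2_eq_square algebra_simps)
  have e: "?e 0 = 1" "?e 1 = 0" "?e 2 = - (g\<^sup>2 * l * (1 - l) / 2)"
    by (simp_all add: fps_nth_gauss_egf)
  have sets: "{0..1} = {0, 1::nat}" "{0..2} = {0, 1, 2::nat}" by auto
  show "fps_nth (ratio_egf l g) 0 = 1" "fps_nth (ratio_egf l g) 1 = 0" "fps_nth (ratio_egf l g) 2 = 0"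
    unfolding ratio_egf_def fps_mult_nth sets using c e by simp_all
qed

text \<open>In the convolution, the constant term of the Bernoulli series contributes at most \<open>v M\<^sup>n\<^sup>-\<^sup>2\<close>, the linear term
vanishes, and the others form a geometric sum of ratio \<open>1/2\<close> bounded by \<open>2 v M\<^sup>n\<^sup>-\<^sup>2\<close>.\<close>

lemma abs_fps_nth_ratio_egf_le:
  assumes l: "0 \<le> l" "l \<le> 1" and g: "\<bar>g\<bar> \<le> M" and M: "M > 0" and n: "n \<ge> 2"
  shows "\<bar>fps_nth (ratio_egf l g) n\<bar> \<le> 3 * (g\<^sup>2 * l * (1 - l)) * M ^ (n - 2)"
proof -
  define v where "v = g\<^sup>2 * l * (1 - l)"
  have v0: "v \<ge> 0" using l by (simp add: v_def)
  have "v = g\<^sup>2 * (l * (1 - l))" by (simp add: v_def)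
  also have "\<dots> \<le> M\<^sup>2 * (1 / 4)"
    using l mult_one_minus_le_quarter[of l] g M by (intro mult_mono) (auto simp: abs_le_square_iff[symmetric])
  finally have v1: "v \<le> M\<^sup>2 / 4" by simp
  note gauss = abs_fps_nth_gauss_egf_le[OF v0 v1 M]
  let ?c = "\<lambda>i. fps_nth (centred_egf l g) i" and ?e = "\<lambda>i. fps_nth (gauss_egf (- v)) i"
  have split: "{0..n} = insert 0 (insert 1 {2..n})" using n by auto
  have c01: "?c 0 = 1" "?c 1 = 0" by (simp_all add: fps_nth_centred_egf)
  have geom: "(\<Sum>i\<in>{2..n}. (1/2) ^ (n - i)) \<le> (2::real)"
  proof -
    have "(\<Sum>i\<in>{2..n}. (1/2) ^ (n - i)) = (\<Sum>i<n-1. (1/2::real) ^ i)"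
      using n by (intro sum.reindex_bij_witness[of _ "\<lambda>i. n - i" "\<lambda>i. n - i"]) auto
    also have "\<dots> \<le> 2" by (subst geometric_sum) (auto simp: field_simps)
    finally show ?thesis .
  qed
  have "fps_nth (ratio_egf l g) n = (\<Sum>i=0..n. ?c i * ?e (n - i))"
    by (simp add: ratio_egf_def fps_mult_nth v_def)
  also have "\<dots> = ?e n + (\<Sum>i\<in>{2..n}. ?c i * ?e (n - i))"
    unfolding split using c01 by simp
  finally have "\<bar>fps_nth (ratio_egf l g) n\<bar> \<le> \<bar>?e n\<bar> + \<bar>\<Sum>i\<in>{2..n}. ?c i * ?e (n - i)\<bar>"
    by simp
  also have "\<dots> \<le> v * M ^ (n - 2) + (\<Sum>i\<in>{2..n}. v * M ^ (n - 2) * (1/2) ^ (n - i))"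
  proof (intro add_mono order_trans[OF sum_abs] sum_mono)
    fix i assume i: "i \<in> {2..n}"
    have "\<bar>?c i * ?e (n - i)\<bar> \<le> (v * M ^ (i - 2)) * (M / 2) ^ (n - i)"
      unfolding abs_mult using abs_fps_nth_centred_egf_le[OF l g, of i] i gauss(1)[of "n - i"] v0 M
      by (intro mult_mono) (auto simp: v_def)
    also have "\<dots> = v * (M ^ (i - 2) * M ^ (n - i)) * (1/2) ^ (n - i)"
      by (simp add: power_divide)
    also have "M ^ (i - 2) * M ^ (n - i) = M ^ (n - 2)"
      using i by (simp flip: power_add)
    finally show "\<bar>?c i * ?e (n - i)\<bar> \<le> v * M ^ (n - 2) * (1/2) ^ (n - i)" .
  qed (use gauss(2) n in auto)
  also have "\<dots> = v * M ^ (n - 2) * (1 + (\<Sum>i\<in>{2..n}. (1/2) ^ (n - i)))"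
    by (simp add: algebra_simps sum_distrib_left)
  also have "\<dots> \<le> v * M ^ (n - 2) * (1 + 2)"
    using geom v0 M by (intro mult_left_mono) auto
  finally show ?thesis by (simp add: v_def mult_ac)
qed

section \<open>A submultiplicative norm that distinguishes parity\<close>

text \<open>Truncation at degree \<open>k\<close> loses nothing, since only coefficients up to degree \<open>k\<close> enter the \<open>k\<close>-th
moment. It also makes convergence a non-issue.\<close>
definition weighted_norm :: "(nat \<Rightarrow> real) \<Rightarrow> nat \<Rightarrow> real fps \<Rightarrow> real" where
  "weighted_norm \<omega> k f = (\<Sum>n\<le>k. \<bar>fps_nth f n\<bar> * \<omega> n)"

lemma weighted_norm_nonneg: "(\<And>n. \<omega> n \<ge> 0) \<Longrightarrow> weighted_norm \<omega> k f \<ge> 0"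
  by (auto simp: weighted_norm_def intro!: sum_nonneg)

lemma weighted_norm_mult:
  assumes nonneg: "\<And>n. \<omega> n \<ge> 0" and submult: "\<And>i j. \<omega> (i + j) \<le> \<omega> i * \<omega> j"
  shows "weighted_norm \<omega> k (f * g) \<le> weighted_norm \<omega> k f * weighted_norm \<omega> k g"
proof -
  define a b where "a = (\<lambda>n. \<bar>fps_nth f n\<bar> * \<omega> n)" and "b = (\<lambda>n. \<bar>fps_nth g n\<bar> * \<omega> n)"
  have ab: "a n \<ge> 0" "b n \<ge> 0" for n using nonneg by (auto simp: a_def b_def)
  have "weighted_norm \<omega> k (f * g) \<le> (\<Sum>n\<le>k. \<Sum>i\<le>n. a i * b (n - i))"
    unfolding weighted_norm_def
  proof (intro sum_mono)
    fix n
    have "\<bar>fps_nth (f * g) n\<bar> * \<omega> n \<le> (\<Sum>i\<le>n. \<bar>fps_nth f i * fps_nth g (n - i)\<bar>) * \<omega> n"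
      unfolding fps_mult_nth atLeast0AtMost using nonneg by (intro mult_right_mono sum_abs)
    also have "\<dots> = (\<Sum>i\<le>n. \<bar>fps_nth f i\<bar> * \<bar>fps_nth g (n - i)\<bar> * \<omega> n)"
      by (simp add: sum_distrib_right abs_mult)
    also have "\<dots> \<le> (\<Sum>i\<le>n. \<bar>fps_nth f i\<bar> * \<bar>fps_nth g (n - i)\<bar> * (\<omega> i * \<omega> (n - i)))"
    proof (intro sum_mono mult_left_mono)
      fix i assume "i \<in> {..n}"
      thus "\<omega> n \<le> \<omega> i * \<omega> (n - i)" using submult[of i "n - i"] by simp
    qed auto
    finally show "\<bar>fps_nth (f * g) n\<bar> * \<omega> n \<le> (\<Sum>i\<le>n. a i * b (n - i))"
      by (simp add: a_def b_def mult_ac)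
  qed
  also have "\<dots> = (\<Sum>(i, j)\<in>{(i, j). i + j \<le> k}. a i * b j)"
    by (rule sum.triangle_reindex_eq[symmetric])
  also have "\<dots> \<le> (\<Sum>(i, j)\<in>{..k} \<times> {..k}. a i * b j)"
    using ab by (intro sum_mono2) auto
  also have "\<dots> = (\<Sum>i\<le>k. a i) * (\<Sum>j\<le>k. b j)"
    by (simp add: sum_product sum.cartesian_product)
  finally show ?thesis by (simp add: weighted_norm_def a_def b_def)
qed

lemma weighted_norm_prod:
  assumes nonneg: "\<And>n. \<omega> n \<ge> 0" and submult: "\<And>i j. \<omega> (i + j) \<le> \<omega> i * \<omega> j" and "\<omega> 0 = 1"
  shows "weighted_norm \<omega> k (\<Prod>x\<in>A. f x) \<le> (\<Prod>x\<in>A. weighted_norm \<omega> k (f x))"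
proof -
  have one: "weighted_norm \<omega> k 1 = 1"
    using \<open>\<omega> 0 = 1\<close> by (simp add: weighted_norm_def if_distribR if_distrib[of "\<lambda>x. x * _"] if_distrib[of abs] cong: if_cong)
  show ?thesis
  proof (induction A rule: infinite_finite_induct)
    case (insert x A)
    have "weighted_norm \<omega> k (f x * (\<Prod>x\<in>A. f x))
        \<le> weighted_norm \<omega> k (f x) * weighted_norm \<omega> k (\<Prod>x\<in>A. f x)"
      by (intro weighted_norm_mult nonneg submult)
    also have "\<dots> \<le> weighted_norm \<omega> k (f x) * (\<Prod>x\<in>A. weighted_norm \<omega> k (f x))"
      using insert by (intro mult_left_mono weighted_norm_nonneg nonneg)
    finally show ?case using insert by simp
  qed (simp_all add: one)
qed

text \<open>The admissible size of a coefficient of degree \<open>n\<close>, relative to \<open>t\<^sup>n\<close>. Odd times odd is even and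
\<open>\<epsilon> * \<epsilon> = \<epsilon>\<^sup>2\<close>, so for \<open>0 < \<epsilon> \<le> 1\<close> products of series respect these sizes.\<close>
definition parity_weight :: "real \<Rightarrow> nat \<Rightarrow> real" where
  "parity_weight \<epsilon> n = (if n = 0 then 1 else if odd n then \<epsilon> else \<epsilon>\<^sup>2)"

lemma parity_weight_mult_le:
  assumes "0 < \<epsilon>" "\<epsilon> \<le> 1"
  shows "parity_weight \<epsilon> i * parity_weight \<epsilon> j \<le> parity_weight \<epsilon> (i + j)"
proof -
  have "\<epsilon>\<^sup>2 \<le> 1" using assms by (intro power_le_one) auto
  hence "\<epsilon> * \<epsilon>\<^sup>2 \<le> \<epsilon>" "\<epsilon>\<^sup>2 * \<epsilon>\<^sup>2 \<le> \<epsilon>\<^sup>2" "\<epsilon>\<^sup>2 * \<epsilon> \<le> \<epsilon>"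
    using assms mult_left_le[of "\<epsilon>\<^sup>2" \<epsilon>] mult_left_le[of "\<epsilon>\<^sup>2" "\<epsilon>\<^sup>2"] by (auto simp: mult.commute)
  thus ?thesis by (auto simp: parity_weight_def simp flip: power2_eq_square)
qed

lemma power_le_parity_weight:
  assumes "0 < \<epsilon>" "\<epsilon> \<le> 1" "n \<ge> 3"
  shows "\<epsilon> ^ (n - 2) \<le> parity_weight \<epsilon> n"
proof (cases "odd n")
  case True
  have "\<epsilon> ^ (n - 2) \<le> \<epsilon> ^ 1" using assms by (intro power_decreasing) auto
  thus ?thesis using True by (auto simp: parity_weight_def)
next
  case False
  hence "n \<noteq> 3" by auto
  have "\<epsilon> ^ (n - 2) \<le> \<epsilon> ^ 2" using assms \<open>n \<noteq> 3\<close> by (intro power_decreasing) auto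
  thus ?thesis using False assms by (auto simp: parity_weight_def)
qed

text \<open>With \<open>M t = \<epsilon> / k\<close> the coefficient of degree \<open>n \<ge> 3\<close> contributes at most
\<open>3 v t\<^sup>2 (\<epsilon> / k)\<^sup>n\<^sup>-\<^sup>2\<close> divided by its weight. The power of \<open>\<epsilon>\<close> is absorbed by the weight, and the sum of
\<open>k\<^sup>2\<^sup>-\<^sup>n\<close> over \<open>3 \<le> n \<le> k\<close> is at most \<open>2 / k\<close>. As \<open>\<sigma>\<^sup>2 t\<^sup>2 = k\<close> in the application, the excesses
over 1 add up to a constant.\<close>

lemma weighted_norm_ratio_egf_le:
  assumes l: "0 \<le> l" "l \<le> 1" and g: "\<bar>g\<bar> \<le> M" and M: "M > 0" and t: "t > 0"
    and \<epsilon>: "0 < \<epsilon>" "\<epsilon> \<le> 1" and Mt: "M * t = \<epsilon> / real k" and k: "k \<ge> 1"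
  shows "weighted_norm (\<lambda>n. t ^ n / parity_weight \<epsilon> n) k (ratio_egf l g)
           \<le> 1 + 6 * (g\<^sup>2 * l * (1 - l)) * t\<^sup>2 / real k"
proof -
  define v where "v = g\<^sup>2 * l * (1 - l)"
  have v: "v \<ge> 0" using l by (simp add: v_def)
  let ?\<omega> = "\<lambda>n. t ^ n / parity_weight \<epsilon> n" and ?f = "\<lambda>n. fps_nth (ratio_egf l g) n"
  have wpos: "parity_weight \<epsilon> n > 0" for n using \<epsilon> by (simp add: parity_weight_def)
  have coeff: "\<bar>?f n\<bar> * ?\<omega> n \<le> 3 * v * t\<^sup>2 * (1 / real k) ^ (n - 2)" if n: "n \<ge> 3" for n
  proof -
    have "\<bar>?f n\<bar> * ?\<omega> n \<le> (3 * v * M ^ (n - 2)) * ?\<omega> n"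
      using abs_fps_nth_ratio_egf_le[OF l g M, of n] n t wpos[of n]
      by (intro mult_right_mono) (auto simp: v_def)
    also have "n = 2 + (n - 2)" using n by simp
    hence "t ^ n = t\<^sup>2 * t ^ (n - 2)" by (metis power_add)
    hence "(3 * v * M ^ (n - 2)) * ?\<omega> n = 3 * v * t\<^sup>2 * ((M * t) ^ (n - 2) / parity_weight \<epsilon> n)"
      by (simp add: power_mult_distrib)
    also have "(M * t) ^ (n - 2) / parity_weight \<epsilon> n = (1 / real k) ^ (n - 2) * (\<epsilon> ^ (n - 2) / parity_weight \<epsilon> n)"
      by (simp add: Mt power_divide)
    also have "3 * v * t\<^sup>2 * \<dots> \<le> 3 * v * t\<^sup>2 * ((1 / real k) ^ (n - 2) * 1)"
      using v t power_le_parity_weight[OF \<epsilon> n] wpos[of n] by (intro mult_left_mono) auto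
    finally show ?thesis by simp
  qed
  \<comment> \<open>The term \<open>n = 3\<close> is \<open>1 / k\<close>; fewer than \<open>k\<close> others are each at most \<open>1 / k\<^sup>2\<close>.\<close>
  have sum: "(\<Sum>n\<in>{3..k}. (1 / real k) ^ (n - 2)) \<le> 2 / real k"
  proof (cases "k \<ge> 3")
    case True
    have "{3..k} = insert 3 {4..k}" using True by auto
    hence "(\<Sum>n\<in>{3..k}. (1 / real k) ^ (n - 2)) = 1 / real k + (\<Sum>n\<in>{4..k}. (1 / real k) ^ (n - 2))"
      by simp
    also have "(\<Sum>n\<in>{4..k}. (1 / real k) ^ (n - 2)) \<le> (\<Sum>n\<in>{4..k}. (1 / real k) ^ 2)"
      using True by (intro sum_mono power_decreasing) auto
    also have "\<dots> = real (k - 3) * (1 / real k) ^ 2" by simp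
    also have "\<dots> \<le> real k * (1 / real k) ^ 2" by (intro mult_right_mono) auto
    also have "\<dots> = 1 / real k" using True by (simp add: power2_eq_square)
    finally show ?thesis by simp
  qed simp
  have "weighted_norm ?\<omega> k (ratio_egf l g) \<le> (\<Sum>n\<in>insert 0 {3..k}. \<bar>?f n\<bar> * ?\<omega> n)"
  proof -
    have "?f n = 0" if "n \<le> k" "n \<notin> insert 0 {3..k}" for n
    proof -
      from that have "n = 1 \<or> n = 2" by auto
      thus ?thesis using ratio_egf_low_coeffs by auto
    qed
    hence "weighted_norm ?\<omega> k (ratio_egf l g) = (\<Sum>n\<in>insert 0 {3..k}. \<bar>?f n\<bar> * ?\<omega> n)"
      unfolding weighted_norm_def by (intro sum.mono_neutral_right) auto
    thus ?thesis by simp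
  qed
  also have "\<dots> = 1 + (\<Sum>n\<in>{3..k}. \<bar>?f n\<bar> * ?\<omega> n)"
    by (simp add: ratio_egf_low_coeffs parity_weight_def)
  also have "(\<Sum>n\<in>{3..k}. \<bar>?f n\<bar> * ?\<omega> n) \<le> (\<Sum>n\<in>{3..k}. 3 * v * t\<^sup>2 * (1 / real k) ^ (n - 2))"
    by (intro sum_mono coeff) auto
  also have "\<dots> = 3 * v * t\<^sup>2 * (\<Sum>n\<in>{3..k}. (1 / real k) ^ (n - 2))"
    by (simp add: sum_distrib_left)
  also have "\<dots> \<le> 3 * v * t\<^sup>2 * (2 / real k)"
    using sum v by (intro mult_left_mono) auto
  finally show ?thesis by (simp add: v_def mult_ac)
qed

section \<open>Gaussian moments and the constant C\<close>

text \<open>In the induction step the ratio of the two sides does not increase because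
\<open>(i + 3/2) (i + 1/2) \<le> (i + 1)\<^sup>2\<close>; at \<open>i = 0\<close> the left-hand side is \<open>\<surd>\<pi> / 2\<close>.\<close>

lemma Gamma_Suc_half_le: "Gamma (real i + 3 / 2) \<le> 2 * fact i * sqrt (real i + 1 / 2)"
proof (induction i)
  case 0
  have "Gamma (3 / 2 :: real) = sqrt pi / 2"
  proof -
    have "(1 / 2 :: real) \<notin> \<int>\<^sub>\<le>\<^sub>0" by (auto dest: nonpos_Ints_nonpos)
    from Gamma_plus1[OF this] show ?thesis by (simp add: Gamma_one_half_real)
  qed
  also have "\<dots> \<le> sqrt 4 / 2" by (intro divide_right_mono real_sqrt_le_mono) (use pi_less_4 in auto)
  also have "\<dots> = sqrt 1" by simp
  also have "\<dots> \<le> sqrt (4 * (1 / 2))" by (intro real_sqrt_le_mono) auto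
  also have "\<dots> = 2 * sqrt (1 / 2)" by (subst real_sqrt_mult) simp
  finally show ?case by simp
next
  case (Suc i)
  have "Gamma (real (Suc i) + 3 / 2) = Gamma (real i + 3 / 2 + 1)" by (simp add: algebra_simps)
  also have "\<dots> = (real i + 3 / 2) * Gamma (real i + 3 / 2)"
    by (rule Gamma_plus1) (auto elim!: nonpos_Ints_cases)
  also have "\<dots> \<le> (real i + 3 / 2) * (2 * fact i * sqrt (real i + 1 / 2))"
    using Suc by (intro mult_left_mono) auto
  also have "\<dots> = 2 * fact i * ((sqrt (real i + 3 / 2) * sqrt (real i + 1 / 2)) * sqrt (real i + 3 / 2))"
    by simp
  also have "sqrt (real i + 3 / 2) * sqrt (real i + 1 / 2) \<le> real i + 1"
    unfolding real_sqrt_mult[symmetric]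
    by (rule real_le_lsqrt) (auto simp: power2_eq_square algebra_simps)
  hence "2 * fact i * ((sqrt (real i + 3 / 2) * sqrt (real i + 1 / 2)) * sqrt (real i + 3 / 2))
     \<le> 2 * fact i * ((real i + 1) * sqrt (real i + 3 / 2))"
    by (intro mult_left_mono mult_right_mono) auto
  also have "\<dots> = 2 * fact (Suc i) * sqrt (real (Suc i) + 1 / 2)"
    by (simp add: algebra_simps)
  finally show ?case .
qed

text \<open>With \<open>k = j + 2 i\<close> this bounds \<open>\<Gamma>(k/2 + 1) / \<Gamma>((k - j)/2 + 1)\<close> by \<open>2 (k/2)\<^sup>j\<^sup>/\<^sup>2\<close>. Raising \<open>j\<close> by two costs
one factor \<open>k/2\<close> by the functional equation; the factor 2 pays for the half-integer step when \<open>j\<close> is odd.\<close>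

lemma Gamma_half_integer_le:
  "Gamma (real (j + 2 * i) / 2 + 1) \<le> 2 * fact i * sqrt (real (j + 2 * i) / 2) ^ j"
proof (induction j rule: nat_less_induct)
  case (1 j)
  consider "j = 0" | "j = 1" | m where "j = Suc (Suc m)"
    by (metis One_nat_def not0_implies_Suc)
  thus ?case
  proof cases
    case 1
    thus ?thesis using Gamma_fact[of i, where 'a = real] by (simp add: add.commute)
  next
    case 2
    thus ?thesis using Gamma_Suc_half_le[of i] by (simp add: field_simps)
  next
    case (3 m)
    define x where "x = real (m + 2 * i) / 2"
    have x: "real (j + 2 * i) / 2 = x + 1" "x \<ge> 0" by (simp_all add: x_def 3 field_simps)
    have "Gamma (x + 1 + 1) = (x + 1) * Gamma (x + 1)"
      using x(2) by (intro Gamma_plus1) (auto elim!: nonpos_Ints_cases)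
    also have "\<dots> \<le> (x + 1) * (2 * fact i * sqrt x ^ m)"
      using 1 3 x(2) by (intro mult_left_mono) (auto simp: x_def)
    also have "\<dots> \<le> (x + 1) * (2 * fact i * sqrt (x + 1) ^ m)"
      using x(2) by (intro mult_left_mono power_mono) auto
    also have "\<dots> = 2 * fact i * sqrt (x + 1) ^ j"
      using x(2) by (simp add: 3)
    finally show ?thesis unfolding x .
  qed
qed

lemma C_pos: "C k > 0"
  unfolding C_def by (intro divide_pos_pos mult_pos_pos Gamma_real_pos) auto

text \<open>Losing \<open>j\<close> degrees in the Gaussian series costs at most a factor \<open>2 (\<surd>k / \<sigma>)\<^sup>j\<close> relative to \<open>C\<^sub>k \<sigma>\<^sup>k\<close>. This explains why
the correction series is measured at \<open>t = \<surd>k / \<sigma>\<close>, and it holds for both parities of \<open>k\<close>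
because the Gamma function interpolates the factorial.\<close>

lemma fact_mult_gauss_egf_le:
  assumes \<sigma>: "\<sigma> > 0" and jk: "j \<le> k" and k: "k \<ge> 1"
  shows "fact k * fps_nth (gauss_egf (\<sigma>\<^sup>2)) (k - j) \<le> 2 * C k * \<sigma> ^ k * (sqrt (real k) / \<sigma>) ^ j"
proof (cases "even (k - j)")
  case False
  thus ?thesis using C_pos[of k] \<sigma> by (auto simp: fps_nth_gauss_egf)
next
  case True
  then obtain i where "k - j = 2 * i" by (elim evenE)
  hence ki: "k = j + 2 * i" using jk by auto
  let ?G = "Gamma (real k / 2 + 1)"
  have G: "?G > 0" by (intro Gamma_real_pos) auto
  have "2 powr (real k / 2) = sqrt 2 ^ k"
    by (simp add: powr_half_sqrt_powr powr_realpow real_sqrt_power)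
  also have "\<dots> = sqrt 2 ^ j * 2 ^ i" by (simp add: ki power_add power_mult)
  finally have p2: "2 powr (real k / 2) = sqrt 2 ^ j * 2 ^ i" .
  have "?G \<le> 2 * fact i * sqrt (real k / 2) ^ j"
    using Gamma_half_integer_le[of j i] by (simp add: ki)
  hence "2 powr (real k / 2) * ?G \<le> (sqrt 2 ^ j * 2 ^ i) * (2 * fact i * sqrt (real k / 2) ^ j)"
    unfolding p2 by (intro mult_left_mono) auto
  also have "\<dots> = 2 * fact i * 2 ^ i * (sqrt 2 * sqrt (real k / 2)) ^ j"
    by (simp add: power_mult_distrib)
  also have "sqrt 2 * sqrt (real k / 2) = sqrt (real k)" by (simp flip: real_sqrt_mult)
  finally have key: "2 powr (real k / 2) * ?G \<le> 2 * fact i * 2 ^ i * sqrt (real k) ^ j" .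
  have "fact k * fps_nth (gauss_egf (\<sigma>\<^sup>2)) (k - j) = fact k * \<sigma> ^ (2 * i) * (1 / (2 ^ i * fact i))"
    by (simp add: fps_nth_gauss_egf ki power_divide power_mult)
  also have "1 / (2 ^ i * fact i) \<le> 2 * sqrt (real k) ^ j / (2 powr (real k / 2) * ?G)"
    using key G by (simp add: field_simps)
  hence "fact k * \<sigma> ^ (2 * i) * (1 / (2 ^ i * fact i)) \<le>
           fact k * \<sigma> ^ (2 * i) * (2 * sqrt (real k) ^ j / (2 powr (real k / 2) * ?G))"
    using \<sigma> by (intro mult_left_mono) auto
  also have "\<dots> = 2 * C k * \<sigma> ^ (2 * i) * sqrt (real k) ^ j"
    using Gamma_fact[of k, where 'a = real] by (simp add: C_def add.commute)
  also have "\<dots> = 2 * C k * \<sigma> ^ k * (sqrt (real k) / \<sigma>) ^ j"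
    using \<sigma> by (simp add: ki power_add power_divide)
  finally show ?thesis .
qed

lemma fact_mult_gauss_egf_eq:
  assumes "even k"
  shows "fact k * fps_nth (gauss_egf (\<sigma>\<^sup>2)) k = C k * \<sigma> ^ k"
proof -
  obtain i where k: "k = 2 * i" using assms by (elim evenE)
  have "C k = fact k / (2 ^ i * fact i)"
    using Gamma_fact[of k, where 'a = real] Gamma_fact[of i, where 'a = real]
    by (simp add: C_def k add.commute powr_realpow)
  thus ?thesis by (simp add: k fps_nth_gauss_egf power_divide power_mult)
qed

section \<open>Moments of sums of centred Bernoulli variables\<close>

text \<open>Only the degrees \<open>j\<close> of the correction series \<open>R\<close> with \<open>j \<equiv> k (mod 2)\<close> meet a nonzero Gaussian
coefficient. For odd \<open>k\<close> they all carry the weight \<open>\<epsilon>\<close>. For even \<open>k\<close> the degree \<open>j = 0\<close> gives the main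
term, and all others carry the weight \<open>\<epsilon>\<^sup>2\<close>.\<close>

lemma centred_moment_bounds:
  assumes P: "finite P" and l: "\<And>p. p \<in> P \<Longrightarrow> 0 \<le> l p \<and> l p \<le> 1"
    and g: "\<And>p. p \<in> P \<Longrightarrow> \<bar>g p\<bar> \<le> M" and M: "M > 0"
    and \<sigma>: "\<sigma> > 0" and \<sigma>2: "\<sigma>\<^sup>2 = (\<Sum>p\<in>P. (g p)\<^sup>2 * l p * (1 - l p))"
    and k: "k \<ge> 1" and \<epsilon>_def: "\<epsilon> = real k * sqrt (real k) * M / \<sigma>" and \<epsilon>: "\<epsilon> \<le> 1"
  defines "m \<equiv> fact k * fps_nth (\<Prod>p\<in>P. centred_egf (l p) (g p)) k"
  shows "even k \<Longrightarrow> \<bar>m - C k * \<sigma> ^ k\<bar> \<le> 2 * exp 6 * \<epsilon>\<^sup>2 * (C k * \<sigma> ^ k)"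
    and "odd k \<Longrightarrow> \<bar>m\<bar> \<le> 2 * exp 6 * \<epsilon> * (C k * \<sigma> ^ k)"
proof -
  define t where "t = sqrt (real k) / \<sigma>"
  define v where "v = (\<lambda>p. (g p)\<^sup>2 * l p * (1 - l p))"
  define \<omega> where "\<omega> = (\<lambda>n. t ^ n / parity_weight \<epsilon> n)"
  define R where "R = (\<Prod>p\<in>P. ratio_egf (l p) (g p))"
  have t: "t > 0" using k \<sigma> by (simp add: t_def)
  have \<epsilon>0: "\<epsilon> > 0" using k \<sigma> M by (simp add: \<epsilon>_def)
  have wpos: "parity_weight \<epsilon> n > 0" for n using \<epsilon>0 by (simp add: parity_weight_def)
  have Mt: "M * t = \<epsilon> / real k" using k by (simp add: t_def \<epsilon>_def field_simps)
  have \<sigma>t: "\<sigma>\<^sup>2 * t\<^sup>2 = real k" using \<sigma> by (simp add: t_def power_divide)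
  have \<omega>_nonneg: "\<omega> n \<ge> 0" for n using t wpos[of n] by (simp add: \<omega>_def)
  have \<omega>_submult: "\<omega> (i + j) \<le> \<omega> i * \<omega> j" for i j
  proof -
    have "\<omega> (i + j) \<le> t ^ (i + j) / (parity_weight \<epsilon> i * parity_weight \<epsilon> j)"
      unfolding \<omega>_def using t wpos parity_weight_mult_le[OF \<epsilon>0 \<epsilon>]
      by (intro divide_left_mono mult_pos_pos) auto
    thus ?thesis by (simp add: \<omega>_def power_add)
  qed
  have \<omega>_0: "\<omega> 0 = 1" by (simp add: \<omega>_def parity_weight_def)

  \<comment> \<open>Submultiplicativity and \<open>1 + x \<le> exp x\<close> turn the product over \<open>p\<close> into the total variance.\<close>
  have "weighted_norm \<omega> k R \<le> (\<Prod>p\<in>P. weighted_norm \<omega> k (ratio_egf (l p) (g p)))"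
    unfolding R_def by (intro weighted_norm_prod \<omega>_nonneg \<omega>_submult \<omega>_0)
  also have "\<dots> \<le> (\<Prod>p\<in>P. exp (6 * v p * t\<^sup>2 / real k))"
  proof (intro prod_mono conjI weighted_norm_nonneg \<omega>_nonneg)
    fix p assume p: "p \<in> P"
    have "weighted_norm \<omega> k (ratio_egf (l p) (g p)) \<le> 1 + 6 * v p * t\<^sup>2 / real k"
      unfolding \<omega>_def v_def using l[OF p] g[OF p] M t \<epsilon>0 \<epsilon> Mt k
      by (intro weighted_norm_ratio_egf_le) auto
    also have "\<dots> \<le> exp (6 * v p * t\<^sup>2 / real k)" by (rule exp_ge_add_one_self)
    finally show "weighted_norm \<omega> k (ratio_egf (l p) (g p)) \<le> exp (6 * v p * t\<^sup>2 / real k)" .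
  qed
  also have "\<dots> = exp (6 * (\<sigma>\<^sup>2 * t\<^sup>2) / real k)"
    using P by (simp add: exp_sum[symmetric] \<sigma>2 v_def sum_distrib_left sum_distrib_right sum_divide_distrib mult_ac)
  also have "\<dots> = exp 6" using k by (simp add: \<sigma>t)
  finally have norm: "weighted_norm \<omega> k R \<le> exp 6" .

  have R: "(\<Prod>p\<in>P. centred_egf (l p) (g p)) = R * gauss_egf (\<sigma>\<^sup>2)"
  proof -
    have "R * gauss_egf (\<sigma>\<^sup>2) =
        (\<Prod>p\<in>P. centred_egf (l p) (g p)) * (gauss_egf (- \<sigma>\<^sup>2) * gauss_egf (\<sigma>\<^sup>2))"
      by (simp add: R_def ratio_egf_def prod.distrib prod_gauss_egf \<sigma>2 sum_negf mult.assoc)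
    also have "gauss_egf (- \<sigma>\<^sup>2) * gauss_egf (\<sigma>\<^sup>2) = 1"
      by (simp add: gauss_egf_0 flip: gauss_egf_add)
    finally show ?thesis by simp
  qed
  define T where "T = (\<lambda>j. fact k * (fps_nth R j * fps_nth (gauss_egf (\<sigma>\<^sup>2)) (k - j)))"
  have m: "m = (\<Sum>j\<le>k. T j)"
    by (simp add: m_def R fps_mult_nth T_def sum_distrib_left atLeast0AtMost)
  have Cpos: "C k * \<sigma> ^ k > 0" using C_pos[of k] \<sigma> by simp
  \<comment> \<open>Terms of the wrong parity vanish; so the weight \<open>\<delta>\<close> is prescribed only for the right parity.\<close>
  have T_le: "\<bar>T j\<bar> \<le> (2 * (C k * \<sigma> ^ k) * \<delta>) * (\<bar>fps_nth R j\<bar> * \<omega> j)"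
    if "j \<le> k" "even (k - j) \<Longrightarrow> parity_weight \<epsilon> j = \<delta>" "\<delta> > 0" for j \<delta>
  proof (cases "even (k - j)")
    case False
    thus ?thesis using that \<omega>_nonneg[of j] Cpos by (simp add: T_def fps_nth_gauss_egf)
  next
    case True
    have nonneg: "fps_nth (gauss_egf (\<sigma>\<^sup>2)) (k - j) \<ge> 0" by (simp add: fps_nth_gauss_egf)
    have "\<bar>T j\<bar> = \<bar>fps_nth R j\<bar> * (fact k * fps_nth (gauss_egf (\<sigma>\<^sup>2)) (k - j))"
      using nonneg by (simp add: T_def abs_mult)
    also have "\<dots> \<le> \<bar>fps_nth R j\<bar> * (2 * C k * \<sigma> ^ k * t ^ j)"
      unfolding t_def using fact_mult_gauss_egf_le[OF \<sigma> that(1) k] by (intro mult_left_mono) auto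
    also have "t ^ j = \<delta> * \<omega> j" using that True by (simp add: \<omega>_def)
    finally show ?thesis by (simp add: mult_ac)
  qed
  have sum_le: "(\<Sum>j\<in>J. (2 * (C k * \<sigma> ^ k) * \<delta>) * (\<bar>fps_nth R j\<bar> * \<omega> j)) \<le> 2 * exp 6 * \<delta> * (C k * \<sigma> ^ k)"
    if "J \<subseteq> {..k}" "\<delta> > 0" for J \<delta>
  proof -
    have "(\<Sum>j\<in>J. \<bar>fps_nth R j\<bar> * \<omega> j) \<le> weighted_norm \<omega> k R"
      unfolding weighted_norm_def using that \<omega>_nonneg by (intro sum_mono2) auto
    also note norm
    finally have "(2 * (C k * \<sigma> ^ k) * \<delta>) * (\<Sum>j\<in>J. \<bar>fps_nth R j\<bar> * \<omega> j) \<le> (2 * (C k * \<sigma> ^ k) * \<delta>) * exp 6"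
      using Cpos that by (intro mult_left_mono) auto
    thus ?thesis by (simp add: sum_distrib_left mult_ac)
  qed

  show "\<bar>m\<bar> \<le> 2 * exp 6 * \<epsilon> * (C k * \<sigma> ^ k)" if "odd k"
  proof -
    have "\<bar>m\<bar> \<le> (\<Sum>j\<le>k. \<bar>T j\<bar>)" unfolding m by (rule sum_abs)
    also have "\<dots> \<le> (\<Sum>j\<le>k. (2 * (C k * \<sigma> ^ k) * \<epsilon>) * (\<bar>fps_nth R j\<bar> * \<omega> j))"
      using that \<epsilon>0 by (intro sum_mono T_le) (auto simp: parity_weight_def)
    also have "\<dots> \<le> 2 * exp 6 * \<epsilon> * (C k * \<sigma> ^ k)" using \<epsilon>0 by (intro sum_le) auto
    finally show ?thesis .
  qed

  show "\<bar>m - C k * \<sigma> ^ k\<bar> \<le> 2 * exp 6 * \<epsilon>\<^sup>2 * (C k * \<sigma> ^ k)" if "even k"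
  proof -
    have "fps_nth R 0 = 1" unfolding R_def by (induction P rule: infinite_finite_induct) (simp_all add: ratio_egf_low_coeffs)
    hence "T 0 = C k * \<sigma> ^ k" using fact_mult_gauss_egf_eq[OF that, of \<sigma>] by (simp add: T_def)
    moreover have "{..k} = insert 0 {1..k}" by auto
    ultimately have "m - C k * \<sigma> ^ k = (\<Sum>j\<in>{1..k}. T j)" by (simp add: m)
    hence "\<bar>m - C k * \<sigma> ^ k\<bar> \<le> (\<Sum>j\<in>{1..k}. \<bar>T j\<bar>)" by (simp add: sum_abs)
    also have "\<dots> \<le> (\<Sum>j\<in>{1..k}. (2 * (C k * \<sigma> ^ k) * \<epsilon>\<^sup>2) * (\<bar>fps_nth R j\<bar> * \<omega> j))"
      using that \<epsilon>0 by (intro sum_mono T_le) (auto simp: parity_weight_def)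
    also have "\<dots> \<le> 2 * exp 6 * \<epsilon>\<^sup>2 * (C k * \<sigma> ^ k)" using \<epsilon>0 by (intro sum_le) auto
    finally show ?thesis .
  qed
qed

section \<open>Moments over a multiset of integers\<close>

text \<open>The expansion over subsets depends on \<open>a\<close> only through the indicators that \<open>\<Prod>Q\<close> divides \<open>a\<close>, whose sum over
the multiset is counted by \<open>h(\<Prod>Q)/\<Prod>Q\<close> times its size plus the remainder. Multiplicativity of \<open>h\<close> makes
the densities multiply, which reproduces the independent model exactly.\<close>

lemma power_sum_remainder_split:
  fixes P :: "nat set"
  assumes h: "multiplicative_fun h" and P: "finite P" "\<And>p. p \<in> P \<Longrightarrow> prime p"
  defines "l \<equiv> \<lambda>p. h p / real p"
  shows "(\<Sum>a\<in>#A. ((\<Sum>p\<in>{p\<in>P. int p dvd a}. g p) - mean h P g) ^ k) =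
           real (size A) * (fact k * fps_nth (\<Prod>p\<in>P. centred_egf (l p) (g p)) k) +
           (\<Sum>Q\<in>Pow P. remainder A h (\<Prod>Q) * subset_weight l g P k Q)"
proof -
  let ?w = "subset_weight l g P k"
  have count: "(\<Sum>a\<in>#A. \<Sum>Q\<in>Pow P. of_bool (\<forall>p\<in>Q. int p dvd a) * ?w Q) =
      (\<Sum>Q\<in>Pow P. real (count_multiples A (\<Prod>Q)) * ?w Q)"
  proof (induction A)
    case (add a A)
    have "of_bool (\<forall>p\<in>Q. int p dvd a) + real (count_multiples A (\<Prod>Q)) =
        real (count_multiples (add_mset a A) (\<Prod>Q))" if "Q \<in> Pow P" for Q
    proof -
      have "finite Q" "\<And>p. p \<in> Q \<Longrightarrow> prime p" using that P finite_subset by auto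
      from prod_primes_dvd_iff[OF this] show ?thesis by (simp add: count_multiples_def)
    qed
    hence "(\<Sum>Q\<in>Pow P. real (count_multiples (add_mset a A) (\<Prod>Q)) * ?w Q) =
        (\<Sum>Q\<in>Pow P. (of_bool (\<forall>p\<in>Q. int p dvd a) + real (count_multiples A (\<Prod>Q))) * ?w Q)"
      by (intro sum.cong) auto
    with add show ?case by (simp add: distrib_right sum.distrib)
  qed (simp add: count_multiples_def)
  have density: "h (\<Prod>Q) / real (\<Prod>Q) = (\<Prod>p\<in>Q. l p)" if "Q \<in> Pow P" for Q
  proof -
    have "finite Q" "\<And>p. p \<in> Q \<Longrightarrow> prime p" using that P finite_subset by auto
    from multiplicative_fun_prod_primes[OF h this] show ?thesis
      by (simp add: l_def prod_dividef)
  qed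
  have mean: "mean h P g = (\<Sum>p\<in>P. g p * l p)" by (simp add: mean_def l_def)
  have "(\<Sum>a\<in>#A. ((\<Sum>p\<in>{p\<in>P. int p dvd a}. g p) - mean h P g) ^ k) =
      (\<Sum>a\<in>#A. \<Sum>Q\<in>Pow P. of_bool (\<forall>p\<in>Q. int p dvd a) * ?w Q)"
    by (simp add: mean power_centred_sum_expand[OF P(1)])
  also have "\<dots> = (\<Sum>Q\<in>Pow P. real (count_multiples A (\<Prod>Q)) * ?w Q)" by (rule count)
  also have "\<dots> = (\<Sum>Q\<in>Pow P. real (size A) * ((\<Prod>p\<in>Q. l p) * ?w Q) + remainder A h (\<Prod>Q) * ?w Q)"
    by (intro sum.cong refl) (simp only: remainder_def density, simp only: algebra_simps)
  also have "\<dots> = real (size A) * (\<Sum>Q\<in>Pow P. (\<Prod>p\<in>Q. l p) * ?w Q) +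
                  (\<Sum>Q\<in>Pow P. remainder A h (\<Prod>Q) * ?w Q)"
    by (simp add: sum.distrib sum_distrib_left)
  finally show ?thesis by (simp add: sum_prod_subset_weight[OF P(1)])
qed

text \<open>The number of primes in a contributing set \<open>Q\<close> is at most \<open>k \<le> \<surd>\<mu>\<close> with \<open>\<mu> = \<Sum> l(p)\<close>, so it can be absorbed:
\<open>(k + \<mu>)\<^sup>k \<le> \<mu>\<^sup>k exp (k\<^sup>2 / \<mu>)\<close>.\<close>

lemma abs_sum_remainder_le:
  fixes P :: "nat set"
  assumes P: "finite P" "\<And>p. p \<in> P \<Longrightarrow> prime p"
    and l: "\<And>p. p \<in> P \<Longrightarrow> 0 \<le> l p \<and> l p \<le> 1" and g: "\<And>p. p \<in> P \<Longrightarrow> \<bar>g p\<bar> \<le> M" and M: "M \<ge> 0"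
    and k: "real k ^ 2 \<le> (\<Sum>p\<in>P. l p)" "k \<ge> 1"
  shows "\<bar>\<Sum>Q\<in>Pow P. r (\<Prod>Q) * subset_weight l g P k Q\<bar>
           \<le> exp 1 * (M ^ k * (\<Sum>p\<in>P. l p) ^ k * (\<Sum>d\<in>D k P. \<bar>r d\<bar>))"
proof -
  let ?w = "subset_weight l g P k" and ?\<mu> = "\<Sum>p\<in>P. l p"
  have \<mu>: "?\<mu> > 0" using k by (smt (verit) of_nat_0_less_iff zero_less_power less_le_trans zero_less_one)
  have "(real k + ?\<mu>) ^ k = ?\<mu> ^ k * (1 + real k / ?\<mu>) ^ k"
    using \<mu> by (simp add: field_simps flip: power_mult_distrib)
  also have "(1 + real k / ?\<mu>) ^ k \<le> exp (real k / ?\<mu>) ^ k"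
    using \<mu> by (intro power_mono exp_ge_add_one_self) auto
  also have "\<dots> = exp (real k ^ 2 / ?\<mu>)" by (simp add: power2_eq_square flip: exp_of_nat_mult)
  also have "\<dots> \<le> exp 1" using k \<mu> by simp
  finally have growth: "(real k + ?\<mu>) ^ k \<le> ?\<mu> ^ k * exp 1" using \<mu> by simp
  have w: "\<bar>?w Q\<bar> \<le> exp 1 * (M ^ k * ?\<mu> ^ k)" if Q: "Q \<subseteq> P" "card Q \<le> k" for Q
  proof -
    have "\<bar>?w Q\<bar> \<le> M ^ k * (real (card Q) + ?\<mu>) ^ k"
      by (rule abs_subset_weight_le[OF P(1) Q(1) l g M])
    also have "\<dots> \<le> M ^ k * (real k + ?\<mu>) ^ k"
      using M Q \<mu> by (intro mult_left_mono power_mono) auto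
    also have "\<dots> \<le> M ^ k * (?\<mu> ^ k * exp 1)" using growth M by (intro mult_left_mono) auto
    finally show ?thesis by (simp add: mult_ac)
  qed
  have "(\<Sum>Q\<in>Pow P. r (\<Prod>Q) * ?w Q) = (\<Sum>Q\<in>{Q\<in>Pow P. card Q \<le> k}. r (\<Prod>Q) * ?w Q)"
    using P(1) by (intro sum.mono_neutral_right) (auto simp: not_le subset_weight_eq_0)
  hence "\<bar>\<Sum>Q\<in>Pow P. r (\<Prod>Q) * ?w Q\<bar> \<le> (\<Sum>Q\<in>{Q\<in>Pow P. card Q \<le> k}. \<bar>r (\<Prod>Q) * ?w Q\<bar>)"
    by (simp only: sum_abs)
  also have "\<dots> \<le> (\<Sum>Q\<in>{Q\<in>Pow P. card Q \<le> k}. exp 1 * (M ^ k * ?\<mu> ^ k) * \<bar>r (\<Prod>Q)\<bar>)"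
  proof (intro sum_mono)
    fix Q assume "Q \<in> {Q \<in> Pow P. card Q \<le> k}"
    hence "\<bar>r (\<Prod>Q)\<bar> * \<bar>?w Q\<bar> \<le> \<bar>r (\<Prod>Q)\<bar> * (exp 1 * (M ^ k * ?\<mu> ^ k))"
      by (intro mult_left_mono w) auto
    thus "\<bar>r (\<Prod>Q) * ?w Q\<bar> \<le> exp 1 * (M ^ k * ?\<mu> ^ k) * \<bar>r (\<Prod>Q)\<bar>"
      by (simp only: abs_mult mult.commute)
  qed
  also have "\<dots> = exp 1 * (M ^ k * ?\<mu> ^ k) * (\<Sum>Q\<in>{Q\<in>Pow P. card Q \<le> k}. \<bar>r (\<Prod>Q)\<bar>)"
    by (simp add: sum_distrib_left)
  also have "\<dots> \<le> exp 1 * (M ^ k * ?\<mu> ^ k) * (\<Sum>d\<in>D k P. \<bar>r d\<bar>)"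
    using M \<mu> by (intro mult_left_mono sum_small_subsets_le_sum_D P) auto
  finally show ?thesis by (simp add: mult_ac)
qed

theorem proposition4:
  "\<exists>c>0. \<forall>(A :: int multiset) (h :: nat \<Rightarrow> real) (P :: nat set) (g :: nat \<Rightarrow> real) (M :: real) (k :: nat).
     multiplicative_fun h \<longrightarrow> (\<forall>n>0. h n \<ge> 0) \<longrightarrow>
     (\<forall>d. squarefree d \<longrightarrow> 0 \<le> h d \<and> h d \<le> real d) \<longrightarrow>
     finite P \<longrightarrow> (\<forall>p\<in>P. prime p) \<longrightarrow>
     strongly_additive_fun g \<longrightarrow> M > 0 \<longrightarrow> (\<forall>p\<in>P. \<bar>g p\<bar> \<le> M) \<longrightarrow>
     k \<ge> 1 \<longrightarrow> real k \<le> (std_dev h P g / M) powr (2 / 3) \<longrightarrow>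
     (even k \<longrightarrow>
        (\<exists>E1 E2 :: real.
           \<bar>E1\<bar> \<le> c * (real k ^ 3 * M\<^sup>2 / (std_dev h P g)\<^sup>2) \<and>
           \<bar>E2\<bar> \<le> c * (M ^ k * (\<Sum>p\<in>P. h p / real p) ^ k * (\<Sum>d\<in>D k P. \<bar>remainder A h d\<bar>)) \<and>
           (\<Sum>a\<in>#A. ((\<Sum>p\<in>{p\<in>P. int p dvd a}. g p) - mean h P g) ^ k)
             = C k * real (size A) * std_dev h P g ^ k * (1 + E1) + E2)) \<and>
     (odd k \<longrightarrow>
        \<bar>\<Sum>a\<in>#A. ((\<Sum>p\<in>{p\<in>P. int p dvd a}. g p) - mean h P g) ^ k\<bar>
          \<le> c * (C k * real (size A) * std_dev h P g ^ k * (real k powr (3 / 2) * M / std_dev h P g)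
                 + M ^ k * (\<Sum>p\<in>P. h p / real p) ^ k * (\<Sum>d\<in>D k P. \<bar>remainder A h d\<bar>)))"
proof (rule exI[of _ "2 * exp (6::real)"], intro conjI allI impI)
  \<comment> \<open>\<open>exp 6\<close> bounds the norm of the correction series, the factor 2 comes from Gamma at half-integers,
    and the errors alone would need only \<open>exp 1\<close>.\<close>
  show "2 * exp (6::real) > 0" by simp
next
  fix A :: "int multiset" and h g :: "nat \<Rightarrow> real" and P :: "nat set" and M :: real and k :: nat
  assume h: "multiplicative_fun h" and h_le: "\<forall>d. squarefree d \<longrightarrow> 0 \<le> h d \<and> h d \<le> real d"
    and P: "finite P" "\<forall>p\<in>P. prime p" and M: "M > 0" and g: "\<forall>p\<in>P. \<bar>g p\<bar> \<le> M"
    and k: "k \<ge> 1" and k_le: "real k \<le> (std_dev h P g / M) powr (2 / 3)"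
  define l where "l = (\<lambda>p. h p / real p)"
  define \<sigma> where "\<sigma> = std_dev h P g"
  define \<mu> where "\<mu> = (\<Sum>p\<in>P. l p)"
  define \<epsilon> where "\<epsilon> = real k * sqrt (real k) * M / \<sigma>"
  define S where "S = (\<Sum>a\<in>#A. ((\<Sum>p\<in>{p\<in>P. int p dvd a}. g p) - mean h P g) ^ k)"
  define R where "R = (\<Sum>d\<in>D k P. \<bar>remainder A h d\<bar>)"
  define m where "m = fact k * fps_nth (\<Prod>p\<in>P. centred_egf (l p) (g p)) k"
  define E where "E = (\<Sum>Q\<in>Pow P. remainder A h (\<Prod>Q) * subset_weight l g P k Q)"

  have prime: "prime p" if "p \<in> P" for p using that P by blast
  have l: "0 \<le> l p \<and> l p \<le> 1" if "p \<in> P" for p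
    using h_le squarefree_prime[OF prime[OF that]] prime_gt_0_nat[OF prime[OF that]]
    by (auto simp: l_def divide_le_eq)
  have var_nonneg: "(g p)\<^sup>2 * l p * (1 - l p) \<ge> 0" if "p \<in> P" for p
    using l[OF that] by simp
  have \<sigma>_def': "\<sigma> = sqrt (\<Sum>p\<in>P. (g p)\<^sup>2 * l p * (1 - l p))"
    by (simp add: \<sigma>_def std_dev_def l_def)
  have \<sigma>2: "\<sigma>\<^sup>2 = (\<Sum>p\<in>P. (g p)\<^sup>2 * l p * (1 - l p))"
    unfolding \<sigma>_def' using var_nonneg by (intro real_sqrt_pow2 sum_nonneg)
  have "\<sigma> \<ge> 0" unfolding \<sigma>_def' using var_nonneg by (intro real_sqrt_ge_zero sum_nonneg)
  \<comment> \<open>For \<open>\<sigma> = 0\<close> the hypothesis would read \<open>k \<le> 0 powr (2/3) = 0\<close>.\<close>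
  moreover have "\<sigma> \<noteq> 0" using k k_le by (auto simp flip: \<sigma>_def)
  ultimately have \<sigma>: "\<sigma> > 0" by simp

  have k32: "real k powr (3 / 2) = real k * sqrt (real k)"
    using k powr_add[of "real k" 1 "1 / 2"] by (simp add: powr_half_sqrt)
  have "real k powr (3 / 2) \<le> ((\<sigma> / M) powr (2 / 3)) powr (3 / 2)"
    using k_le by (intro powr_mono2) (auto simp: \<sigma>_def)
  also have "\<dots> = \<sigma> / M" using \<sigma> M by (simp add: powr_powr)
  finally have k32_le: "real k powr (3 / 2) \<le> \<sigma> / M" .
  have \<epsilon>: "\<epsilon> \<le> 1" using k32_le \<sigma> M by (simp add: \<epsilon>_def k32 field_simps)
  have "\<epsilon>\<^sup>2 = (real k)\<^sup>2 * (sqrt (real k))\<^sup>2 * M\<^sup>2 / \<sigma>\<^sup>2"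
    by (simp only: \<epsilon>_def power_divide power_mult_distrib)
  hence \<epsilon>2: "\<epsilon>\<^sup>2 = real k ^ 3 * M\<^sup>2 / \<sigma>\<^sup>2"
    by (simp add: power2_eq_square power3_eq_cube)

  \<comment> \<open>The hypothesis on \<open>k\<close> says \<open>k\<^sup>3 \<le> \<sigma>\<^sup>2 / M\<^sup>2\<close>, and \<open>\<sigma>\<^sup>2 \<le> M\<^sup>2 \<mu>\<close>; so \<open>\<mu> \<ge> k\<^sup>3 \<ge> k\<^sup>2\<close>.\<close>
  have "\<sigma>\<^sup>2 \<le> (\<Sum>p\<in>P. M\<^sup>2 * l p * 1)"
    unfolding \<sigma>2
  proof (intro sum_mono)
    fix p assume p: "p \<in> P"
    have "(g p)\<^sup>2 \<le> M\<^sup>2" using g p M by (auto simp flip: abs_le_square_iff)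
    thus "(g p)\<^sup>2 * l p * (1 - l p) \<le> M\<^sup>2 * l p * 1"
      using l[OF p] by (intro mult_mono) auto
  qed
  hence "\<sigma>\<^sup>2 \<le> M\<^sup>2 * \<mu>" by (simp add: \<mu>_def sum_distrib_left)
  moreover have "real k ^ 3 * M\<^sup>2 \<le> \<sigma>\<^sup>2"
  proof -
    have "\<epsilon>\<^sup>2 \<le> 1" using \<epsilon> k \<sigma> M by (intro power_le_one) (auto simp: \<epsilon>_def)
    thus ?thesis using \<epsilon>2 \<sigma> by (simp add: divide_le_eq)
  qed
  ultimately have "M\<^sup>2 * real k ^ 3 \<le> M\<^sup>2 * \<mu>" by (simp add: mult.commute)
  hence "real k ^ 3 \<le> \<mu>" using M by simp
  moreover have "real k ^ 2 \<le> real k ^ 3" using k by (intro power_increasing) auto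
  ultimately have k2: "real k ^ 2 \<le> \<mu>" by linarith
  have \<mu>: "\<mu> \<ge> 0" using l by (auto simp: \<mu>_def intro!: sum_nonneg)

  have S: "S = real (size A) * m + E"
    unfolding S_def m_def E_def l_def by (rule power_sum_remainder_split[OF h P(1) prime])
  have "\<bar>E\<bar> \<le> exp 1 * (M ^ k * \<mu> ^ k * R)"
    unfolding E_def R_def \<mu>_def using g M k k2 l prime P(1) 
    by (intro abs_sum_remainder_le) (auto simp: \<mu>_def)
  also have "\<dots> \<le> (2 * exp 6) * (M ^ k * \<mu> ^ k * R)"
  proof (rule mult_right_mono)
    have "exp 1 \<le> exp (6 :: real)" by simp
    thus "exp 1 \<le> 2 * exp (6 :: real)" by (smt (verit) exp_gt_zero)
    show "M ^ k * \<mu> ^ k * R \<ge> 0" using M \<mu> by (simp add: R_def sum_nonneg)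
  qed
  finally have E: "\<bar>E\<bar> \<le> 2 * exp 6 * (M ^ k * \<mu> ^ k * R)" .
  have g': "\<And>p. p \<in> P \<Longrightarrow> \<bar>g p\<bar> \<le> M" using g by blast
  note moment = centred_moment_bounds[OF P(1) l g' M \<sigma> \<sigma>2 k \<epsilon>_def \<epsilon>, folded m_def]
  have Cpos: "C k * \<sigma> ^ k > 0" using C_pos[of k] \<sigma> by simp

  {
    assume "even k"
    define E1 where "E1 = (m - C k * \<sigma> ^ k) / (C k * \<sigma> ^ k)"
    have "\<bar>E1\<bar> \<le> 2 * exp 6 * \<epsilon>\<^sup>2"
      using moment(1)[OF _ _ \<open>even k\<close>] Cpos by (simp add: E1_def abs_divide pos_divide_le_eq)
    moreover have "C k * \<sigma> ^ k * E1 = m - C k * \<sigma> ^ k"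
    proof -
      have "C k * \<sigma> ^ k \<noteq> 0" using Cpos by linarith
      thus ?thesis unfolding E1_def times_divide_eq_right by (rule nonzero_mult_div_cancel_left)
    qed
    hence "m = C k * \<sigma> ^ k * (1 + E1)" by (simp add: distrib_left)
    hence "S = C k * real (size A) * \<sigma> ^ k * (1 + E1) + E" by (simp add: S mult_ac)
    ultimately show "\<exists>E1 E2 :: real.
           \<bar>E1\<bar> \<le> 2 * exp 6 * (real k ^ 3 * M\<^sup>2 / (std_dev h P g)\<^sup>2) \<and>
           \<bar>E2\<bar> \<le> 2 * exp 6 * (M ^ k * (\<Sum>p\<in>P. h p / real p) ^ k * (\<Sum>d\<in>D k P. \<bar>remainder A h d\<bar>)) \<and>
           (\<Sum>a\<in>#A. ((\<Sum>p\<in>{p\<in>P. int p dvd a}. g p) - mean h P g) ^ k)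
             = C k * real (size A) * std_dev h P g ^ k * (1 + E1) + E2"
      using E unfolding S_def[symmetric] \<sigma>_def[symmetric] R_def[symmetric] \<epsilon>2 \<mu>_def l_def by blast
  }
  {
    assume "odd k"
    have "\<bar>S\<bar> \<le> real (size A) * \<bar>m\<bar> + \<bar>E\<bar>"
      unfolding S by (rule order_trans[OF abs_triangle_ineq]) (simp add: abs_mult)
    also have "\<dots> \<le> real (size A) * (2 * exp 6 * \<epsilon> * (C k * \<sigma> ^ k)) + 2 * exp 6 * (M ^ k * \<mu> ^ k * R)"
      using moment(2)[OF _ _ \<open>odd k\<close>] E by (intro add_mono mult_left_mono) auto
    also have "\<dots> = 2 * exp 6 * (C k * real (size A) * \<sigma> ^ k * \<epsilon> + M ^ k * \<mu> ^ k * R)"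
      by (simp add: algebra_simps)
    finally show "\<bar>\<Sum>a\<in>#A. ((\<Sum>p\<in>{p\<in>P. int p dvd a}. g p) - mean h P g) ^ k\<bar>
          \<le> 2 * exp 6 * (C k * real (size A) * std_dev h P g ^ k * (real k powr (3 / 2) * M / std_dev h P g)
                 + M ^ k * (\<Sum>p\<in>P. h p / real p) ^ k * (\<Sum>d\<in>D k P. \<bar>remainder A h d\<bar>))"
      unfolding S_def[symmetric] \<sigma>_def[symmetric] R_def[symmetric] k32 \<epsilon>_def \<mu>_def l_def .
  }
qed

end
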